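(* Let $l\ge 0$ be an integer, let $\sigma,\tau,w$ on the fundamental interval $(a,b)$ and $P_l$ be as in the context, and let the complementary polynomials ${\cal P}_\nu(x;l)$, $\nu=0,1,\dots,l$, be defined in terms of the generalized Rodrigues representation $$P_l(x)=\frac{1}{w(x)}\frac{d^{\,l-\nu}}{dx^{\,l-\nu}}\Big(\sigma(x)^{l-\nu}w(x)\,{\cal P}_\nu(x;l)\Big),\qquad \nu=0,1,\dots,l.$$ Then ${\cal P}_\nu(x;l)$ is a polynomial of degree $\nu$ that satisfies the recursive differential equation $${\cal P}_{\nu+1}(x;l)=\sigma(x)\frac{d{\cal P}_\nu(x;l)}{dx}+[\tau(x)+(l-\nu-1)\sigma'(x)]\,{\cal P}_\nu(x;l),$$ and, by the Rodrigues formula for $P_l$, ${\cal P}_0(x;l)\equiv 1$.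
   Context: $\sigma(x)=ex^2+2fx+g$ is a real polynomial of degree at most $2$ and $\tau(x)=a_l+b_lx$ is a real polynomial of degree at most $1$, whose coefficients may depend on $l$. The weight function $w$, possibly dependent on $l$, lives on the fundamental interval $(a,b)$, which contains no zero of $\sigma$; $w$ is nonvanishing there and satisfies Pearson's equation $\sigma(x)w'(x)=[\tau(x)-\sigma'(x)]w(x)$. $P_l$ is the polynomial generated by the Rodrigues formula $P_l(x)=\frac{1}{w(x)}\frac{d^l}{dx^l}\big(\sigma(x)^l w(x)\big)$, $l=0,1,\dots$; it is a real polynomial solution of $\sigma P_l''+\tau P_l'+\Lambda_lP_l=0$ with $\Lambda_l=-l\tau'-\frac{l}{2}(l-1)\sigma''$.
   Formalization: The representation fixes the complementary polynomials only up to integration constants; proved: a polynomial family with it, the recursion and P_0=1 exists, unique up to these constants. Degree is at most ν, and exactly ν when P_l has degree l (for σ=1, τ=0, w=1, P_1=0). *)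

theory Defs
  imports "HOL-Analysis.Analysis" "HOL-Computational_Algebra.Polynomial"
begin

text \<open>
  \<open>deriv\<close> is total, so an iterated derivative \<open>(deriv ^^ n) F\<close> is meaningful on an open set \<open>S\<close>
  only together with the following condition.
\<close>

definition times_differentiable_on :: "nat \<Rightarrow> (real \<Rightarrow> real) \<Rightarrow> real set \<Rightarrow> bool" where
  "times_differentiable_on n F S \<longleftrightarrow> (\<forall>j<n. \<forall>x\<in>S. (deriv ^^ j) F differentiable (at x))"

definition generalized_rodrigues ::
  "real poly \<Rightarrow> (real \<Rightarrow> real) \<Rightarrow> real set \<Rightarrow> nat \<Rightarrow> (real \<Rightarrow> real) \<Rightarrow> nat \<Rightarrow> (real \<Rightarrow> real) \<Rightarrow> bool" where
  "generalized_rodrigues \<sigma> w S l p \<nu> Q \<longleftrightarrow>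
     times_differentiable_on (l - \<nu>) (\<lambda>y. poly \<sigma> y ^ (l - \<nu>) * w y * Q y) S \<and>
     (\<forall>x\<in>S. p x = 1 / w x * (deriv ^^ (l - \<nu>)) (\<lambda>y. poly \<sigma> y ^ (l - \<nu>) * w y * Q y) x)"

text \<open>
  The representation determines \<open>Q\<close> only up to the constants of integration of the \<open>l - \<nu>\<close>
  derivatives, that is, up to \<open>r / (\<sigma> ^ (l - \<nu>) * w)\<close> with \<open>r\<close> a polynomial of degree below
  \<open>l - \<nu>\<close>. This ambiguity can survive among polynomials: for \<open>\<sigma> = 1 - x\<^sup>2\<close>, \<open>\<tau> = 0\<close>,
  \<open>w = 1 / (1 - x\<^sup>2)\<close>, \<open>l = 2\<close>, \<open>\<nu> = 1\<close> every \<open>Q = - 2 x + c\<close> satisfies it.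
\<close>

definition equal_up_to_integration_constants ::
  "real poly \<Rightarrow> (real \<Rightarrow> real) \<Rightarrow> real set \<Rightarrow> nat \<Rightarrow> (real \<Rightarrow> real) \<Rightarrow> (real \<Rightarrow> real) \<Rightarrow> bool" where
  "equal_up_to_integration_constants \<sigma> w S n Q R \<longleftrightarrow>
     (\<exists>r :: real poly. (r = 0 \<or> degree r < n) \<and>
        (\<forall>x\<in>S. Q x = R x + poly r x / (poly \<sigma> x ^ n * w x)))"

end

theory Submission
  imports Defs
begin

text \<open>
  Pearson's equation gives \<open>(\<sigma> ^ Suc m * w * q)' = \<sigma> ^ m * w * (\<sigma> * q' + (\<tau> + m * \<sigma>') * q)\<close> for
  every polynomial \<open>q\<close>. Hence the polynomials defined by \<open>C 0 = 1\<close> and the recursion satisfy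
  \<open>(\<sigma> ^ (l - \<nu>) * w * C \<nu>)\<^bsup>(j)\<^esup> = \<sigma> ^ (l - \<nu> - j) * w * C (\<nu> + j)\<close>. Taking \<open>\<nu> = 0\<close> and \<open>j = l\<close>
  identifies \<open>C l\<close> with \<open>P\<close>, after which \<open>j = l - \<nu>\<close> is the representation of \<open>P\<close> by \<open>C \<nu>\<close>.
  Each recursion step raises the degree by at most one, so \<open>degree P = l\<close> forces every step to
  raise it by exactly one.
\<close>

text \<open>Termwise integration, with division by \<open>Suc i\<close> justified by characteristic
  zero. The degree bound ensures that each integration raises the degree of the ambiguity by at most
  one.\<close>

lemma ex_pderiv_eq:
  fixes r :: "'a :: field_char_0 poly"
  obtains R where "pderiv R = r" "degree R \<le> Suc (degree r)"
proof
  let ?R = "\<Sum>i\<le>degree r. monom (coeff r i / of_nat (Suc i)) (Suc i)"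
  have "pderiv ?R = (\<Sum>i\<le>degree r. monom (coeff r i) i)"
    by (simp add: higher_pderiv_sum[of 1, simplified] pderiv_monom del: of_nat_Suc)
  then show "pderiv ?R = r"
    by (simp add: poly_as_sum_of_monoms)
  show "degree ?R \<le> Suc (degree r)"
    by (intro degree_sum_le) (auto intro: order_trans[OF degree_monom_le])
qed

lemma times_differentiable_on_Suc:
  "times_differentiable_on (Suc n) F S \<longleftrightarrow>
     (\<forall>x\<in>S. F differentiable (at x)) \<and> times_differentiable_on n (deriv F) S"
  unfolding times_differentiable_on_def
  by (auto simp: less_Suc_eq_0_disj funpow_swap1)

lemma deriv_cong_open:
  assumes "open S" "x \<in> S" "\<And>y. y \<in> S \<Longrightarrow> f y = g y"
  shows "deriv f x = deriv g x"
  using assms by (intro deriv_cong_ev) (auto simp: eventually_nhds)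

lemma differentiable_cong_open:
  fixes f g :: "real \<Rightarrow> real"
  assumes "open S" "x \<in> S" "\<And>y. y \<in> S \<Longrightarrow> f y = g y" "g differentiable (at x)"
  shows "f differentiable (at x)"
  using assms has_derivative_transform_within_open[of g _ x UNIV S f]
  unfolding differentiable_def by fastforce

text \<open>Induction on \<open>n\<close>: the hypothesis applied to the first derivatives gives
  \<open>r\<close>. Subtracting an antiderivative \<open>R\<close> of \<open>r\<close> from
  \<open>F - G\<close> leaves a function with zero derivative, which connectedness makes a single
  constant.\<close>

lemma equal_higher_deriv_imp_diff_poly:
  fixes F G :: "real \<Rightarrow> real"
  assumes S: "open S" "connected S"
    and "times_differentiable_on n F S" "times_differentiable_on n G S"
    and "\<And>x. x \<in> S \<Longrightarrow> (deriv ^^ n) F x = (deriv ^^ n) G x"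
  shows "\<exists>r :: real poly. (r = 0 \<or> degree r < n) \<and> (\<forall>x\<in>S. F x = G x + poly r x)"
  using assms(3-)
proof (induction n arbitrary: F G)
  case 0
  then show ?case by auto
next
  case (Suc n)
  obtain r :: "real poly" where r: "r = 0 \<or> degree r < n"
      "\<And>x. x \<in> S \<Longrightarrow> deriv F x = deriv G x + poly r x"
    using Suc.IH[of "deriv F" "deriv G"] Suc.prems
    by (simp add: times_differentiable_on_Suc funpow_Suc_right del: funpow.simps) blast
  obtain R where R: "pderiv R = r" "degree R \<le> Suc (degree r)"
    by (rule ex_pderiv_eq)
  have "((\<lambda>x. F x - G x - poly R x) has_field_derivative 0) (at x)" if "x \<in> S" for x
  proof -
    have F: "(F has_field_derivative deriv F x) (at x)" "(G has_field_derivative deriv G x) (at x)"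
      using Suc.prems(1,2) that
      by (auto simp: times_differentiable_on_Suc DERIV_deriv_iff_real_differentiable)
    have "((\<lambda>x. F x - G x - poly R x) has_field_derivative deriv F x - deriv G x - poly r x) (at x)"
      using F poly_DERIV[of R x] unfolding R(1) by (intro DERIV_diff) auto
    then show ?thesis
      using r(2)[OF that] by simp
  qed
  then have "(\<lambda>x. F x - G x - poly R x) constant_on S"
    by (rule has_field_derivative_0_imp_constant_on[OF _ S(2,1)])
  then obtain c where c: "\<And>x. x \<in> S \<Longrightarrow> F x - G x - poly R x = c"
    unfolding constant_on_def by blast
  \<comment> \<open>The case \<open>r = 0\<close> is separate because \<open>n\<close> may then be
    0, and the bound on \<open>degree R\<close> would only give 1; instead \<open>R\<close> is
    constant.\<close>
  have "degree (R + [:c:]) < Suc n"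
  proof (cases "r = 0")
    case True
    then show ?thesis using R(1) by (simp add: pderiv_eq_0_iff degree_add_le less_Suc_eq_le)
  next
    case False
    then show ?thesis using R(2) r(1) by (intro degree_add_less) auto
  qed
  moreover have "\<forall>x\<in>S. F x = G x + poly (R + [:c:]) x"
    using c by (auto simp: algebra_simps)
  ultimately show ?case by blast
qed

text \<open>The factor is a difference of reals, so it does not truncate at 0; for \<nu> < l it
  equals \<open>real (l - Suc \<nu>)\<close>.\<close>

primrec complementary_poly :: "real poly \<Rightarrow> real poly \<Rightarrow> nat \<Rightarrow> nat \<Rightarrow> real poly" where
  "complementary_poly \<sigma> \<tau> l 0 = 1"
| "complementary_poly \<sigma> \<tau> l (Suc \<nu>) =
     \<sigma> * pderiv (complementary_poly \<sigma> \<tau> l \<nu>) +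
     (\<tau> + smult (real l - real \<nu> - 1) (pderiv \<sigma>)) * complementary_poly \<sigma> \<tau> l \<nu>"

text \<open>Multiplying by \<sigma> adds at most 2 to the degree and differentiating a nonconstant
  \<open>q\<close> removes 1; for constant \<open>q\<close> that summand vanishes. The other factor
  is at most linear for every \<open>c\<close>.\<close>

lemma degree_complementary_step_le:
  fixes \<sigma> \<tau> q :: "real poly"
  assumes "degree \<sigma> \<le> 2" "degree \<tau> \<le> 1"
  shows "degree (\<sigma> * pderiv q + (\<tau> + smult c (pderiv \<sigma>)) * q) \<le> Suc (degree q)"
proof (rule degree_add_le)
  show "degree (\<sigma> * pderiv q) \<le> Suc (degree q)"
  proof (cases "degree q = 0")
    case True
    then show ?thesis by (simp add: pderiv_eq_0_iff[THEN iffD2])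
  next
    case False
    then show ?thesis
      using assms(1) degree_mult_le[of \<sigma> "pderiv q"] by (simp add: degree_pderiv)
  qed
  have "degree (\<tau> + smult c (pderiv \<sigma>)) \<le> 1"
    using assms degree_smult_le[of c "pderiv \<sigma>"] by (intro degree_add_le) (auto simp: degree_pderiv)
  then show "degree ((\<tau> + smult c (pderiv \<sigma>)) * q) \<le> Suc (degree q)"
    using degree_mult_le[of "\<tau> + smult c (pderiv \<sigma>)" q] by linarith
qed

text \<open>Starting at index 0 this bounds degrees from above; ending at index \<open>l\<close> it
  bounds the degree at the starting index from below.\<close>

lemma degree_complementary_poly_add_le:
  assumes "degree \<sigma> \<le> 2" "degree \<tau> \<le> 1"
  shows "degree (complementary_poly \<sigma> \<tau> l (\<nu> + j)) \<le> degree (complementary_poly \<sigma> \<tau> l \<nu>) + j"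
proof (induction j)
  case (Suc j)
  then show ?case
    using degree_complementary_step_le[OF assms, of "complementary_poly \<sigma> \<tau> l (\<nu> + j)"]
    by (fastforce intro: order_trans)
qed simp

text \<open>After the product rule and extraction of \<open>poly \<sigma> x ^ m\<close>, one factor
  \<sigma> remains to meet \<open>deriv w\<close>. Pearson's equation replaces that product, and its
  term with -\<sigma>' lowers the coefficient \<open>Suc m\<close> to \<open>m\<close>.\<close>

lemma pearson_has_field_derivative:
  fixes \<sigma> \<tau> q :: "real poly" and w :: "real \<Rightarrow> real"
  assumes "w differentiable (at x)"
    and "poly \<sigma> x * deriv w x = (poly \<tau> x - poly (pderiv \<sigma>) x) * w x"
  shows "((\<lambda>y. poly \<sigma> y ^ Suc m * w y * poly q y) has_field_derivative
           poly \<sigma> x ^ m * w x * poly (\<sigma> * pderiv q + (\<tau> + smult (real m) (pderiv \<sigma>)) * q) x) (at x)"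
proof -
  have w: "(w has_field_derivative deriv w x) (at x)"
    using assms(1) by (simp add: DERIV_deriv_iff_real_differentiable)
  let ?s = "poly \<sigma> x" and ?s' = "poly (pderiv \<sigma>) x"
  have "((\<lambda>y. poly \<sigma> y ^ Suc m * w y * poly q y) has_field_derivative
      (real (Suc m) * (?s' * ?s ^ m) * w x + deriv w x * ?s ^ Suc m) * poly q x +
      poly (pderiv q) x * (?s ^ Suc m * w x)) (at x)"
    using DERIV_mult[OF DERIV_mult[OF DERIV_power[OF poly_DERIV[of \<sigma> x], of "Suc m"] w] poly_DERIV[of q x]]
    by simp
  moreover have "(real (Suc m) * (?s' * ?s ^ m) * w x + deriv w x * ?s ^ Suc m) * poly q x +
      poly (pderiv q) x * (?s ^ Suc m * w x) =
      ?s ^ m * ((real (Suc m) * ?s' * w x + ?s * deriv w x) * poly q x + poly (pderiv q) x * ?s * w x)"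
    by (simp add: algebra_simps)
  moreover have "\<dots> = ?s ^ m * w x * poly (\<sigma> * pderiv q + (\<tau> + smult (real m) (pderiv \<sigma>)) * q) x"
    unfolding assms(2) by (simp add: algebra_simps)
  ultimately show ?thesis
    by (simp only:)
qed

text \<open>Both claims share one proof: the closed form of each intermediate derivative also shows
  that it is differentiable again.\<close>

lemma
  fixes \<sigma> \<tau> :: "real poly" and w :: "real \<Rightarrow> real" and l :: nat
  defines "C \<equiv> complementary_poly \<sigma> \<tau> l"
  assumes S: "open S"
    and w: "\<And>x. x \<in> S \<Longrightarrow> w differentiable (at x)"
    and pearson: "\<And>x. x \<in> S \<Longrightarrow> poly \<sigma> x * deriv w x = (poly \<tau> x - poly (pderiv \<sigma>) x) * w x"
  shows higher_deriv_complementary_poly: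
      "\<nu> + j \<le> l \<Longrightarrow> x \<in> S \<Longrightarrow>
         (deriv ^^ j) (\<lambda>y. poly \<sigma> y ^ (l - \<nu>) * w y * poly (C \<nu>) y) x =
         poly \<sigma> x ^ (l - \<nu> - j) * w x * poly (C (\<nu> + j)) x"
    and times_differentiable_complementary_poly:
      "times_differentiable_on (l - \<nu>) (\<lambda>y. poly \<sigma> y ^ (l - \<nu>) * w y * poly (C \<nu>) y) S"
proof -
  let ?F = "\<lambda>\<nu> y. poly \<sigma> y ^ (l - \<nu>) * w y * poly (C \<nu>) y"
  have step: "(?F \<nu> has_field_derivative ?F (Suc \<nu>) x) (at x)" if "\<nu> < l" "x \<in> S" for \<nu> x
    using pearson_has_field_derivative[OF w pearson, OF that(2,2), of "l - Suc \<nu>" "C \<nu>"] that(1)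
    by (simp add: C_def Suc_diff_Suc of_nat_diff algebra_simps del: power_Suc)
  have iter: "(deriv ^^ j) (?F \<nu>) x = ?F (\<nu> + j) x" if "\<nu> + j \<le> l" "x \<in> S" for \<nu> j x
    using that
  proof (induction j arbitrary: x)
    case (Suc j)
    \<comment> \<open>The induction hypothesis is an equality on \<open>S\<close> only; openness of
      \<open>S\<close> lets it pass under \<open>deriv\<close>.\<close>
    then have "(deriv ^^ Suc j) (?F \<nu>) x = deriv (?F (\<nu> + j)) x"
      using deriv_cong_open[OF S, of x "(deriv ^^ j) (?F \<nu>)" "?F (\<nu> + j)"] by simp
    also have "\<dots> = ?F (\<nu> + Suc j) x"
      using DERIV_imp_deriv[OF step[of "\<nu> + j" x]] Suc.prems by simp
    finally show ?case .
  qed simp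
  show "\<nu> + j \<le> l \<Longrightarrow> x \<in> S \<Longrightarrow>
      (deriv ^^ j) (?F \<nu>) x = poly \<sigma> x ^ (l - \<nu> - j) * w x * poly (C (\<nu> + j)) x"
    using iter[of \<nu> j x] by simp
  have "(deriv ^^ j) (?F \<nu>) differentiable (at x)" if "j < l - \<nu>" "x \<in> S" for j x
  proof (rule differentiable_cong_open[OF S \<open>x \<in> S\<close>, of _ "?F (\<nu> + j)"])
    show "(deriv ^^ j) (?F \<nu>) y = ?F (\<nu> + j) y" if "y \<in> S" for y
      using iter[of \<nu> j y] that \<open>j < l - \<nu>\<close> by simp
    show "?F (\<nu> + j) differentiable (at x)"
      unfolding real_differentiable_def
      using step[of "\<nu> + j" x] that by (auto simp: less_diff_conv add.commute)
  qed
  then show "times_differentiable_on (l - \<nu>) (?F \<nu>) S"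
    by (simp add: times_differentiable_on_def)
qed

text \<open>Equality of degrees is conditional because the degree can drop: for \<sigma> = 1, \<tau>
  = 0, w = 1, l = 1 both \<open>P\<close> and \<open>C 1\<close> are 0.\<close>

theorem theorem1:
  fixes l :: nat
    and \<sigma> \<tau> P :: "real poly"
    and w :: "real \<Rightarrow> real"
    and a b :: ereal
  assumes deg_\<sigma>: "degree \<sigma> \<le> 2"
    and deg_\<tau>: "degree \<tau> \<le> 1"
    and interval: "a < b"
    and \<sigma>_nonzero: "\<forall>x\<in>einterval a b. poly \<sigma> x \<noteq> 0"
    and w_nonzero: "\<forall>x\<in>einterval a b. w x \<noteq> 0"
    and w_diff: "\<forall>x\<in>einterval a b. w differentiable (at x)"
    and pearson: "\<forall>x\<in>einterval a b.
       poly \<sigma> x * deriv w x = (poly \<tau> x - poly (pderiv \<sigma>) x) * w x"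
    and rodrigues: "\<forall>x\<in>einterval a b.
       poly P x = 1 / w x * (deriv ^^ l) (\<lambda>y. poly \<sigma> y ^ l * w y) x"
  shows "\<exists>C :: nat \<Rightarrow> real poly.
     (\<forall>\<nu>\<le>l. generalized_rodrigues \<sigma> w (einterval a b) l (poly P) \<nu> (poly (C \<nu>))) \<and>
     (\<forall>\<nu>\<le>l. \<forall>Q :: real \<Rightarrow> real.
        generalized_rodrigues \<sigma> w (einterval a b) l (poly P) \<nu> Q \<longrightarrow>
        equal_up_to_integration_constants \<sigma> w (einterval a b) (l - \<nu>) Q (poly (C \<nu>))) \<and>
     (\<forall>\<nu>\<le>l. degree (C \<nu>) \<le> \<nu>) \<and>
     (degree P = l \<longrightarrow> (\<forall>\<nu>\<le>l. degree (C \<nu>) = \<nu>)) \<and>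
     (\<forall>\<nu><l. C (Suc \<nu>) =
        \<sigma> * pderiv (C \<nu>) + (\<tau> + smult (real l - real \<nu> - 1) (pderiv \<sigma>)) * C \<nu>) \<and>
     C 0 = 1"
proof -
  let ?S = "einterval a b"
  let ?C = "complementary_poly \<sigma> \<tau> l"
  let ?F = "\<lambda>\<nu> Q y. poly \<sigma> y ^ (l - \<nu>) * w y * Q y"
  have "open ?S"
    by simp
  have "connected ?S"
    unfolding is_interval_connected_1[symmetric] is_interval_1
    by (auto simp: einterval_iff intro: less_le_trans[of a "ereal _"] le_less_trans[of _ "ereal _" b])
  have "?S \<noteq> {}"
    using einterval_nonempty[OF interval] by blast
  note higher_deriv = higher_deriv_complementary_poly[OF \<open>open ?S\<close> w_diff[rule_format] pearson[rule_format]]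
  note times_diff = times_differentiable_complementary_poly[OF \<open>open ?S\<close> w_diff[rule_format] pearson[rule_format]]
  \<comment> \<open>At \<open>j = l\<close> the power of \<sigma> has exponent 0, so only
    \<open>w\<close> has to be cancelled. Agreement on an infinite set then identifies the
    polynomials.\<close>
  have "poly P x = poly (?C l) x" if "x \<in> ?S" for x
    using higher_deriv[where \<nu> = 0 and j = l] that rodrigues w_nonzero by simp
  then have "?S \<subseteq> {x. poly (P - ?C l) x = 0}"
    by auto
  moreover have "infinite ?S"
    using \<open>?S \<noteq> {}\<close> \<open>open ?S\<close> finite_imp_not_open by blast
  ultimately have P: "P = ?C l"
    using poly_roots_finite[of "P - ?C l"] finite_subset by fastforce
  have repr: "generalized_rodrigues \<sigma> w ?S l (poly P) \<nu> (poly (?C \<nu>))" if "\<nu> \<le> l" for \<nu>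
    unfolding generalized_rodrigues_def
    using that times_diff higher_deriv[where \<nu> = \<nu> and j = "l - \<nu>"] w_nonzero by (simp add: P)
  have uniq: "equal_up_to_integration_constants \<sigma> w ?S (l - \<nu>) Q (poly (?C \<nu>))"
    if "\<nu> \<le> l" and Q: "generalized_rodrigues \<sigma> w ?S l (poly P) \<nu> Q" for \<nu> Q
  proof -
    have eq: "(deriv ^^ (l - \<nu>)) (?F \<nu> Q) x = (deriv ^^ (l - \<nu>)) (?F \<nu> (poly (?C \<nu>))) x"
      if "x \<in> ?S" for x
      using Q repr[OF \<open>\<nu> \<le> l\<close>] that w_nonzero unfolding generalized_rodrigues_def by simp
    obtain r :: "real poly" where r: "r = 0 \<or> degree r < l - \<nu>"
        "\<And>x. x \<in> ?S \<Longrightarrow> ?F \<nu> Q x = ?F \<nu> (poly (?C \<nu>)) x + poly r x"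
      using equal_higher_deriv_imp_diff_poly[OF \<open>open ?S\<close> \<open>connected ?S\<close> _ times_diff eq] Q
      unfolding generalized_rodrigues_def by blast
    \<comment> \<open>Division by the common factor is possible as neither \<sigma> nor
      \<open>w\<close> vanishes on the interval.\<close>
    have "Q x = poly (?C \<nu>) x + poly r x / (poly \<sigma> x ^ (l - \<nu>) * w x)" if "x \<in> ?S" for x
      using r(2)[OF that] \<sigma>_nonzero w_nonzero that by (simp add: field_simps)
    with r(1) show ?thesis
      unfolding equal_up_to_integration_constants_def by blast
  qed
  have le: "degree (?C \<nu>) \<le> \<nu>" for \<nu>
    using degree_complementary_poly_add_le[OF deg_\<sigma> deg_\<tau>, of l 0 \<nu>] by simp
  \<comment> \<open>Since \<open>P = ?C l\<close>, the growth bound gives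
    \<open>l \<le> degree (?C \<nu>) + (l - \<nu>)\<close>, the missing lower bound.\<close>
  have "degree (?C \<nu>) = \<nu>" if "degree P = l" "\<nu> \<le> l" for \<nu>
    using degree_complementary_poly_add_le[OF deg_\<sigma> deg_\<tau>, of l \<nu> "l - \<nu>"] le[of \<nu>] that P by simp
  with repr uniq le show ?thesis
    by (intro exI[of _ ?C] conjI) auto
qed

end
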